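(* Suppose that $U$ is a subset of $F^1_{USCB}(X)$. Then $U$ is totally bounded in $(F^1_{USCB}(X), H_{\rm send})$ if and only if $U(0)$ is totally bounded in $(X,d)$.
   Context: $(X,d)$ is a nonempty metric space. $X\times[0,1]$ carries the metric $\overline d((x,\alpha),(y,\beta))=d(x,y)+|\alpha-\beta|$. A fuzzy set in $X$ is a function $u:X\to[0,1]$. Its $\alpha$-cuts are $[u]_\alpha=\{x\in X: u(x)\ge\alpha\}$ for $\alpha\in(0,1]$ and $[u]_0=\overline{\{x\in X:u(x)>0\}}$ (closure in $X$). $C(Y)$ and $K(Y)$ denote the sets of nonempty closed, respectively nonempty compact, subsets of a metric space $Y$. $F^1_{USC}(X)$ is the set of fuzzy sets $u$ in $X$ with $[u]_\alpha\in C(X)$ for all $\alpha\in[0,1]$; $F^1_{USCB}(X)$ is the set of $u\in F^1_{USC}(X)$ with $[u]_0\in K(X)$. For nonempty closed sets $A,B$, $H^*(A,B)=\sup_{a\in A}\inf_{b\in B}\rho(a,b)$ and $H(A,B)=\max\{H^*(A,B),H^*(B,A)\}$ is the Hausdorff distance, where $\rho$ is the underlying metric ($d$ on $X$, $\overline d$ on $X\times[0,1]$). The sendograph is ${\rm send}\,u=\{(x,t)\in X\times[0,1]:u(x)\ge t\}\cap([u]_0\times[0,1])$, and $H_{\rm send}(u,v)=H({\rm send}\,u,{\rm send}\,v)$ (computed with $\overline d$), which is a metric on $F^1_{USCB}(X)$. For a set $U$ of fuzzy sets, $U(0)=\bigcup_{u\in U}[u]_0$. *)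

theory Defs
  imports "HOL-Analysis.Analysis"
begin

definition fuzzy_set :: "('a \<Rightarrow> real) \<Rightarrow> bool" where
  "fuzzy_set u \<longleftrightarrow> (\<forall>x. u x \<in> {0..1})"

definition fuzzy_cut :: "('a::metric_space \<Rightarrow> real) \<Rightarrow> real \<Rightarrow> 'a set" where
  "fuzzy_cut u \<alpha> = (if \<alpha> = 0 then closure {x. u x > 0} else {x. u x \<ge> \<alpha>})"

definition F1_USC :: "('a::metric_space \<Rightarrow> real) set" where
  "F1_USC = {u. fuzzy_set u \<and> (\<forall>\<alpha>\<in>{0..1}. closed (fuzzy_cut u \<alpha>) \<and> fuzzy_cut u \<alpha> \<noteq> {})}"

definition F1_USCB :: "('a::metric_space \<Rightarrow> real) set" where
  "F1_USCB = {u \<in> F1_USC. compact (fuzzy_cut u 0) \<and> fuzzy_cut u 0 \<noteq> {}}"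

text \<open>The metric on \<open>X \<times> [0,1]\<close>. It is the sum metric, not the Euclidean one that the
  library puts on product types, so \<open>dist\<close> on pairs is not used.\<close>

definition dbar :: "'a::metric_space \<times> real \<Rightarrow> 'a \<times> real \<Rightarrow> real" where
  "dbar p q = dist (fst p) (fst q) + \<bar>snd p - snd q\<bar>"

text \<open>The Hausdorff distance with respect to a metric \<open>\<rho>\<close> may be infinite on unbounded sets,
  hence the extended values.\<close>

definition Hstar :: "('b \<Rightarrow> 'b \<Rightarrow> real) \<Rightarrow> 'b set \<Rightarrow> 'b set \<Rightarrow> ennreal" where
  "Hstar \<rho> A B = (SUP a\<in>A. INF b\<in>B. ennreal (\<rho> a b))"

definition Hausdorff :: "('b \<Rightarrow> 'b \<Rightarrow> real) \<Rightarrow> 'b set \<Rightarrow> 'b set \<Rightarrow> ennreal" where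
  "Hausdorff \<rho> A B = max (Hstar \<rho> A B) (Hstar \<rho> B A)"

definition send :: "('a::metric_space \<Rightarrow> real) \<Rightarrow> ('a \<times> real) set" where
  "send u = {(x, t). t \<in> {0..1} \<and> u x \<ge> t} \<inter> (fuzzy_cut u 0 \<times> {0..1})"

text \<open>On \<open>F1_USCB\<close> the Hausdorff distance of sendographs is finite (lemma
  \<open>Hausdorff_send_finite\<close> below), so \<open>enn2real\<close> loses nothing there.\<close>

definition H_send :: "('a::metric_space \<Rightarrow> real) \<Rightarrow> ('a \<Rightarrow> real) \<Rightarrow> real" where
  "H_send u v = enn2real (Hausdorff dbar (send u) (send v))"

definition support_union :: "('a::metric_space \<Rightarrow> real) set \<Rightarrow> 'a set" where
  "support_union U = (\<Union>u\<in>U. fuzzy_cut u 0)"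


lemma dbar_nonneg: "0 \<le> dbar p q"
  by (simp add: dbar_def)

lemma dbar_triangle: "dbar p r \<le> dbar p q + dbar q r"
  using dist_triangle[of "fst p" "fst r" "fst q"] by (simp add: dbar_def)

lemma dbar_commute: "dbar p q = dbar q p"
  by (simp add: dbar_def dist_commute abs_minus_commute)

lemma INF_ennreal_add:
  fixes f :: "'b \<Rightarrow> ennreal"
  assumes "A \<noteq> {}"
  shows "(INF i\<in>A. f i + c) = (INF i\<in>A. f i) + c"
  using assms continuous_at_Inf_mono[of "\<lambda>x. x + c" "f`A"]
    continuous_add[of "at_right (Inf (f`A))", of "\<lambda>x. x" "\<lambda>x. c"]
  by (auto simp: mono_def image_comp)

lemma Hstar_triangle: "Hstar dbar A C \<le> Hstar dbar A B + Hstar dbar B C"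
  unfolding Hstar_def[of dbar A C]
proof (rule SUP_least)
  fix a assume a: "a \<in> A"
  have "(INF c\<in>C. ennreal (dbar a c)) \<le> ennreal (dbar a b) + Hstar dbar B C" if b: "b \<in> B" for b
  proof -
    have "(INF c\<in>C. ennreal (dbar a c)) \<le> (INF c\<in>C. ennreal (dbar a b) + ennreal (dbar b c))"
      by (intro INF_mono) (metis dbar_nonneg dbar_triangle ennreal_leI ennreal_plus)
    also have "\<dots> = ennreal (dbar a b) + (INF c\<in>C. ennreal (dbar b c))"
      by (cases "C = {}") (simp_all add: INF_ennreal_add add.commute[of "ennreal (dbar a b)"])
    also have "\<dots> \<le> ennreal (dbar a b) + Hstar dbar B C"
      unfolding Hstar_def by (intro add_left_mono SUP_upper b)
    finally show ?thesis .
  qed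
  then have "(INF c\<in>C. ennreal (dbar a c)) \<le> (INF b\<in>B. ennreal (dbar a b) + Hstar dbar B C)"
    by (intro INF_greatest)
  also have "\<dots> = (INF b\<in>B. ennreal (dbar a b)) + Hstar dbar B C"
    by (cases "B = {}") (simp_all add: INF_ennreal_add)
  also have "\<dots> \<le> Hstar dbar A B + Hstar dbar B C"
    unfolding Hstar_def[of dbar A B] by (intro add_right_mono SUP_upper a)
  finally show "(INF c\<in>C. ennreal (dbar a c)) \<le> Hstar dbar A B + Hstar dbar B C" .
qed

lemma Hausdorff_triangle: "Hausdorff dbar A C \<le> Hausdorff dbar A B + Hausdorff dbar B C"
proof -
  have "Hstar dbar A C \<le> Hausdorff dbar A B + Hausdorff dbar B C"
    by (rule order_trans[OF Hstar_triangle[of _ _ B]]) (auto simp: Hausdorff_def intro: add_mono)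
  moreover have "Hstar dbar C A \<le> Hausdorff dbar A B + Hausdorff dbar B C"
    by (rule order_trans[OF Hstar_triangle[of _ _ B]], subst add.commute)
      (auto simp: Hausdorff_def intro: add_mono)
  ultimately show ?thesis
    unfolding Hausdorff_def[of dbar A C] by simp
qed

lemma mem_send:
  "(x, t) \<in> send u \<longleftrightarrow> t \<in> {0..1} \<and> t \<le> u x \<and> x \<in> fuzzy_cut u 0"
  by (auto simp: send_def)

lemma send_nonempty: "u \<in> F1_USCB \<Longrightarrow> send u \<noteq> {}"
proof -
  assume u: "u \<in> F1_USCB"
  then obtain x where "x \<in> fuzzy_cut u 0" by (auto simp: F1_USCB_def)
  then have "(x, 0) \<in> send u"
    using u by (auto simp: mem_send F1_USCB_def F1_USC_def fuzzy_set_def)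
  then show ?thesis by blast
qed

lemma Hstar_send_finite:
  assumes u: "u \<in> F1_USCB" and v: "v \<in> F1_USCB"
  shows "Hstar dbar (send u) (send v) < top"
proof -
  have "bounded (fuzzy_cut u 0 \<union> fuzzy_cut v 0)"
    using u v by (auto simp: F1_USCB_def intro: compact_imp_bounded)
  then obtain C where C: "\<forall>x\<in>fuzzy_cut u 0 \<union> fuzzy_cut v 0. \<forall>y\<in>fuzzy_cut u 0 \<union> fuzzy_cut v 0. dist x y \<le> C"
    unfolding bounded_two_points by blast
  obtain q where q: "q \<in> send v" using send_nonempty[OF v] by blast
  have "Hstar dbar (send u) (send v) \<le> ennreal (C + 1)"
    unfolding Hstar_def
  proof (rule SUP_least)
    fix p assume p: "p \<in> send u"
    have "dbar p q \<le> C + 1"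
      using p q C[rule_format, of "fst p" "fst q"] by (cases p; cases q) (auto simp: mem_send dbar_def)
    then show "(INF q\<in>send v. ennreal (dbar p q)) \<le> ennreal (C + 1)"
      by (intro INF_lower2[OF q] ennreal_leI)
  qed
  then show ?thesis by (rule order.strict_trans1) simp
qed

lemma Hausdorff_send_finite:
  "u \<in> F1_USCB \<Longrightarrow> v \<in> F1_USCB \<Longrightarrow> Hausdorff dbar (send u) (send v) < top"
  by (simp add: Hausdorff_def Hstar_send_finite)

lemma Hstar_send_zero_imp_le:
  assumes u: "u \<in> F1_USCB" and v: "v \<in> F1_USCB"
    and z: "Hstar dbar (send u) (send v) = 0"
  shows "u x \<le> v x"
proof (rule ccontr)
  assume "\<not> u x \<le> v x"
  define s where "s = (u x + v x) / 2"
  have range: "0 \<le> v x" "u x \<le> 1" "v x < u x"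
    using u v \<open>\<not> u x \<le> v x\<close> by (auto simp: F1_USCB_def F1_USC_def fuzzy_set_def)
  then have s: "v x < s" "s < u x" "0 < s" "s \<le> 1" by (auto simp: s_def)
  have "x \<in> fuzzy_cut u 0"
    unfolding fuzzy_cut_def using range closure_subset by fastforce
  then have xu: "(x, u x) \<in> send u"
    using range by (auto simp: mem_send)
  have inf0: "(INF q\<in>send v. ennreal (dbar (x, u x) q)) = 0"
    using SUP_upper[OF xu, of "\<lambda>p. INF q\<in>send v. ennreal (dbar p q)"] z
    by (simp add: Hstar_def)
  then have near: "\<exists>q\<in>send v. dbar (x, u x) q < e" if "e > 0" for e
  proof -
    have "(INF q\<in>send v. ennreal (dbar (x, u x) q)) < ennreal e"
      using that inf0 by simp
    then show ?thesis
      unfolding INF_less_iff by (simp add: ennreal_less_iff dbar_nonneg)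
  qed
  have "x \<in> closure (fuzzy_cut v s)"
    unfolding closure_approachable
  proof safe
    fix e :: real assume e: "0 < e"
    then obtain y t where yt: "(y, t) \<in> send v" "dbar (x, u x) (y, t) < min e (u x - s)"
      using near[of "min e (u x - s)"] s by force
    then have "dist y x + \<bar>u x - t\<bar> < e" "dist y x + \<bar>u x - t\<bar> < u x - s" "t \<le> v y"
      by (simp_all add: dbar_def dist_commute mem_send)
    then have "dist y x < e" "s \<le> v y"
      using zero_le_dist[of y x] by linarith+
    then show "\<exists>y\<in>fuzzy_cut v s. dist y x < e"
      using s by (auto simp: fuzzy_cut_def)
  qed
  moreover have "closed (fuzzy_cut v s)"
    using v s by (auto simp: F1_USCB_def F1_USC_def)
  ultimately show False
    using s by (simp add: fuzzy_cut_def)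
qed

lemma Metric_space_H_send: "Metric_space F1_USCB H_send"
proof
  fix u v w :: "'a \<Rightarrow> real"
  show "0 \<le> H_send u v" by (simp add: H_send_def)
  show "H_send u v = H_send v u" by (simp add: H_send_def Hausdorff_def max.commute)
  assume u: "u \<in> F1_USCB" and v: "v \<in> F1_USCB"
  show "H_send u v = 0 \<longleftrightarrow> u = v"
  proof
    assume "H_send u v = 0"
    then have "Hausdorff dbar (send u) (send v) = 0"
      using Hausdorff_send_finite[OF u v] by (auto simp: H_send_def enn2real_eq_0_iff)
    then have "Hstar dbar (send u) (send v) = 0" "Hstar dbar (send v) (send u) = 0"
      by (auto simp: Hausdorff_def max_def split: if_splits)
    then show "u = v"
      using Hstar_send_zero_imp_le[OF u v] Hstar_send_zero_imp_le[OF v u]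
      by (intro ext antisym) auto
  next
    assume "u = v"
    have "(INF q\<in>send v. ennreal (dbar p q)) \<le> 0" if "p \<in> send v" for p
      by (rule INF_lower2[OF that]) (simp add: dbar_def)
    then have "Hstar dbar (send v) (send v) \<le> 0"
      unfolding Hstar_def by (rule SUP_least)
    then show "H_send u v = 0"
      using \<open>u = v\<close> by (simp add: H_send_def Hausdorff_def)
  qed
  assume w: "w \<in> F1_USCB"
  obtain a b where ab: "Hausdorff dbar (send u) (send v) = ennreal a" "0 \<le> a"
    "Hausdorff dbar (send v) (send w) = ennreal b" "0 \<le> b"
    using Hausdorff_send_finite[OF u v] Hausdorff_send_finite[OF v w]
    by (metis ennreal_cases less_irrefl)
  then have "Hausdorff dbar (send u) (send w) \<le> ennreal (a + b)"
    using Hausdorff_triangle[of "send u" "send w" "send v"] by simp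
  then show "H_send u w \<le> H_send u v + H_send v w"
    using ab enn2real_mono[of "Hausdorff dbar (send u) (send w)" "ennreal (a + b)"]
    by (simp add: H_send_def del: ennreal_plus)
qed

end

theory Submission
  imports Defs
begin

text \<open>Both directions rest on the fact that the second coordinate of a sendograph lives in the
  compact interval \<open>[0,1]\<close>, so that only the first coordinate can obstruct total boundedness.

  If \<open>U\<close> is totally bounded, a finite net of \<open>U\<close> consists of finitely many fuzzy sets with compact
  supports. A point \<open>x\<close> in the support of a member \<open>u\<close> gives the point \<open>(x, 0)\<close> of \<open>send u\<close>, and the
  first coordinate of a nearby point in the sendograph of a net element lies in one of these supports
  and is close to \<open>x\<close>. Hence the supports of the net elements, whose union is compact, approximate
  \<open>U(0)\<close>, and a finite net of that union serves for \<open>U(0)\<close>.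

  If \<open>U(0)\<close> is totally bounded, the product of a net of \<open>U(0)\<close> with a net of \<open>[0,1]\<close> is a finite
  net \<open>N\<close> for all sendographs at once (\<open>finite_net_sendographs\<close>). Attach to each \<open>u\<close> its trace, the
  set of points of \<open>N\<close> that are close to \<open>send u\<close>. Two fuzzy sets with the same trace have close
  sendographs (\<open>Hausdorff_le_of_net_trace_eq\<close>), and there are only finitely many traces since \<open>N\<close> has
  finitely many subsets. One representative for each trace that occurs is a finite net of \<open>U\<close>
  (\<open>mtotally_boundedI_finite_image\<close>).\<close>

lemma totally_bounded_metric_iff:
  fixes S :: "'a::metric_space set"
  shows "totally_bounded S \<longleftrightarrow> (\<forall>e>0. \<exists>X. finite X \<and> (\<forall>s\<in>S. \<exists>x\<in>X. dist x s < e))"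
proof
  assume S: "totally_bounded S"
  show "\<forall>e>0. \<exists>X. finite X \<and> (\<forall>s\<in>S. \<exists>x\<in>X. dist x s < e)"
  proof (intro allI impI)
    fix e :: real assume "e > 0"
    then have ev: "eventually (\<lambda>(x, y). dist x y < e) (uniformity :: ('a \<times> 'a) filter)"
      unfolding eventually_uniformity_metric by (intro exI[of _ e]) simp
    show "\<exists>X. finite X \<and> (\<forall>s\<in>S. \<exists>x\<in>X. dist x s < e)"
      using S[unfolded totally_bounded_def, rule_format, OF ev] by simp
  qed
next
  assume R: "\<forall>e>0. \<exists>X. finite X \<and> (\<forall>s\<in>S. \<exists>x\<in>X. dist x s < e)"
  show "totally_bounded S"
    unfolding totally_bounded_def
  proof (intro allI impI)
    fix E :: "'a \<times> 'a \<Rightarrow> bool" assume "eventually E uniformity"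
    then obtain e where e: "e > 0" "\<And>x y. dist x y < e \<Longrightarrow> E (x, y)"
      unfolding eventually_uniformity_metric by blast
    moreover obtain X where "finite X" "\<forall>s\<in>S. \<exists>x\<in>X. dist x s < e"
      using R[rule_format, OF e(1)] by blast
    ultimately show "\<exists>X. finite X \<and> (\<forall>s\<in>S. \<exists>x\<in>X. E (x, s))"
      by (intro exI[of _ X]) fast
  qed
qed

lemma compact_finite_net:
  fixes S :: "'a::metric_space set"
  assumes "compact S" "e > 0"
  obtains X where "finite X" "\<And>s. s \<in> S \<Longrightarrow> \<exists>x\<in>X. dist x s < e"
proof -
  obtain X where "finite X" "S \<subseteq> (\<Union>x\<in>X. ball x e)"
    using assms unfolding compact_eq_totally_bounded by blast
  then show thesis
    by (intro that[of X]) (auto simp: subset_eq)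
qed

lemma Hstar_le:
  assumes "\<And>a. a \<in> A \<Longrightarrow> \<exists>b\<in>B. \<rho> a b \<le> e"
  shows "Hstar \<rho> A B \<le> ennreal e"
  unfolding Hstar_def
proof (rule SUP_least)
  fix a assume "a \<in> A"
  then obtain b where "b \<in> B" "\<rho> a b \<le> e" using assms by blast
  then show "(INF b\<in>B. ennreal (\<rho> a b)) \<le> ennreal e"
    by (intro INF_lower2[of b] ennreal_leI)
qed

lemma Hstar_lessD:
  assumes "Hstar dbar A B < ennreal e" "a \<in> A"
  shows "\<exists>b\<in>B. dbar a b < e"
proof -
  have "(INF b\<in>B. ennreal (dbar a b)) \<le> Hstar dbar A B"
    unfolding Hstar_def by (rule SUP_upper[OF assms(2)])
  then have "(INF b\<in>B. ennreal (dbar a b)) < ennreal e"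
    using assms(1) by (rule le_less_trans)
  then show ?thesis
    unfolding INF_less_iff by (simp add: ennreal_less_iff dbar_nonneg)
qed

lemma H_send_less_imp_near:
  assumes "u \<in> F1_USCB" "v \<in> F1_USCB" "H_send u v < e" "p \<in> send v"
  shows "\<exists>q\<in>send u. dbar p q < e"
proof -
  have "Hausdorff dbar (send u) (send v) = ennreal (H_send u v)"
    using Hausdorff_send_finite[OF assms(1,2)] by (simp add: H_send_def)
  then have "Hausdorff dbar (send u) (send v) < ennreal e"
    using assms(3) by (metis H_send_def enn2real_nonneg ennreal_less_iff)
  then have "Hstar dbar (send v) (send u) < ennreal e"
    by (simp add: Hausdorff_def)
  then show ?thesis using assms(4) by (rule Hstar_lessD)
qed

definition net_trace :: "real \<Rightarrow> ('a::metric_space \<times> real) set \<Rightarrow> ('a \<times> real) set \<Rightarrow> ('a \<times> real) set"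
  where "net_trace d N A = {n \<in> N. \<exists>p\<in>A. dbar n p < d}"

text \<open>A point of \<open>A\<close> is near some point of \<open>N\<close>, which belongs to the trace of \<open>A\<close>, hence to that
  of \<open>B\<close>, and is therefore near a point of \<open>B\<close>.\<close>

lemma Hstar_le_of_net_trace_subset:
  assumes net: "\<And>p. p \<in> A \<Longrightarrow> \<exists>n\<in>N. dbar n p < d"
    and sub: "net_trace d N A \<subseteq> net_trace d N B"
  shows "Hstar dbar A B \<le> ennreal (2 * d)"
proof (rule Hstar_le)
  fix p assume p: "p \<in> A"
  then obtain n where n: "n \<in> N" "dbar n p < d" using net by blast
  then have "n \<in> net_trace d N B" using p sub by (auto simp: net_trace_def)
  then obtain q where "q \<in> B" "dbar n q < d" by (auto simp: net_trace_def)
  then show "\<exists>q\<in>B. dbar p q \<le> 2 * d"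
    using n dbar_triangle[of p q n] by (intro bexI[of _ q]) (auto simp: dbar_commute[of p n])
qed

lemma Hausdorff_le_of_net_trace_eq:
  assumes "\<And>p. p \<in> A \<union> B \<Longrightarrow> \<exists>n\<in>N. dbar n p < d" "net_trace d N A = net_trace d N B"
  shows "Hausdorff dbar A B \<le> ennreal (2 * d)"
  unfolding Hausdorff_def using assms
  by (intro max.boundedI Hstar_le_of_net_trace_subset[where N = N]) auto

lemma finite_net_sendographs:
  assumes tb: "totally_bounded (support_union U)" and "d > 0"
  obtains N where "finite N" "\<And>u p. u \<in> U \<Longrightarrow> p \<in> send u \<Longrightarrow> \<exists>n\<in>N. dbar n p < d"
proof -
  obtain X where X: "finite X" "\<And>x. x \<in> support_union U \<Longrightarrow> \<exists>y\<in>X. dist y x < d/2"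
    using tb \<open>d > 0\<close> unfolding totally_bounded_metric_iff by (meson half_gt_zero)
  obtain T where T: "finite T" "\<And>t. t \<in> {0..1::real} \<Longrightarrow> \<exists>s\<in>T. dist s t < d/2"
    using compact_finite_net[of "{0..1::real}" "d/2"] \<open>d > 0\<close> by auto
  show thesis
  proof
    show "finite (X \<times> T)" using X T by simp
    fix u p assume "u \<in> U" "p \<in> send u"
    then obtain x t where p: "p = (x, t)" "x \<in> support_union U" "t \<in> {0..1}"
      by (cases p) (auto simp: mem_send support_union_def)
    obtain y s where "y \<in> X" "dist y x < d/2" "s \<in> T" "dist s t < d/2"
      using X(2)[OF p(2)] T(2)[OF p(3)] by blast
    then show "\<exists>n\<in>X \<times> T. dbar n p < d"
      using p by (intro bexI[of _ "(y, s)"]) (auto simp: dbar_def dist_real_def)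
  qed
qed

text \<open>The net consists of one element from each of the finitely many fibres of \<open>f\<close>. This form suits
  spaces of sets or functions, where the points of a net must be members of \<open>S\<close> and cannot be written
  down explicitly.\<close>

lemma (in Metric_space) mtotally_boundedI_finite_image:
  assumes "S \<subseteq> M"
    and "\<And>e. e > 0 \<Longrightarrow> \<exists>f :: 'a \<Rightarrow> 'b. finite (f ` S) \<and> (\<forall>x\<in>S. \<forall>y\<in>S. f x = f y \<longrightarrow> d x y < e)"
  shows "mtotally_bounded S"
  unfolding mtotally_bounded_def
proof (intro allI impI)
  fix e :: real assume "e > 0"
  then obtain f :: "'a \<Rightarrow> 'b" where f: "finite (f ` S)" "\<And>x y. \<lbrakk>x \<in> S; y \<in> S; f x = f y\<rbrakk> \<Longrightarrow> d x y < e"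
    using assms(2)[of e] by blast
  obtain K where K: "K \<subseteq> S" "finite K" "f ` S = f ` K"
    using finite_subset_image[OF f(1) order_refl] by blast
  have "S \<subseteq> (\<Union>x\<in>K. mball x e)"
  proof
    fix x assume x: "x \<in> S"
    then obtain k where "k \<in> K" "f k = f x" using K(3) by (metis (no_types) imageE imageI)
    then show "x \<in> (\<Union>x\<in>K. mball x e)"
      using x K(1) assms(1) f(2)[of k x] by (auto simp: subset_iff)
  qed
  then show "\<exists>K. finite K \<and> K \<subseteq> S \<and> S \<subseteq> (\<Union>x\<in>K. mball x e)"
    using K by blast
qed

lemma totally_bounded_support_union:
  fixes U :: "('a::metric_space \<Rightarrow> real) set"
  assumes U: "U \<subseteq> F1_USCB" and tb: "Metric_space.mtotally_bounded F1_USCB H_send U"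
  shows "totally_bounded (support_union U)"
  unfolding totally_bounded_metric_iff
proof (intro allI impI)
  interpret Metric_space "F1_USCB :: ('a \<Rightarrow> real) set" H_send by (rule Metric_space_H_send)
  fix e :: real assume "e > 0"
  then have e2: "e / 2 > 0" by simp
  obtain K where K: "finite K" "K \<subseteq> U" "U \<subseteq> (\<Union>k\<in>K. mball k (e/2))"
    using tb[unfolded mtotally_bounded_def, rule_format, OF e2] by blast
  have "compact (\<Union>k\<in>K. fuzzy_cut k 0)"
    using K U by (intro compact_UN) (auto simp: F1_USCB_def)
  then obtain X where X: "finite X" "\<And>y. y \<in> (\<Union>k\<in>K. fuzzy_cut k 0) \<Longrightarrow> \<exists>x\<in>X. dist x y < e/2"
    using compact_finite_net[OF _ e2] by blast
  have "\<exists>x\<in>X. dist x s < e" if s: "s \<in> support_union U" for s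
  proof -
    obtain u where u: "u \<in> U" "s \<in> fuzzy_cut u 0" using s by (auto simp: support_union_def)
    then obtain k where k: "k \<in> K" "u \<in> F1_USCB" "k \<in> F1_USCB" "H_send k u < e/2"
      using K(3) by (auto simp: subset_iff)
    have "(s, 0) \<in> send u"
      using u(2) k(2) by (auto simp: mem_send F1_USCB_def F1_USC_def fuzzy_set_def)
    then obtain y t where y: "(y, t) \<in> send k" "dbar (s, 0) (y, t) < e/2"
      using H_send_less_imp_near[OF k(3,2,4)] by (metis surj_pair)
    then have "dist y s < e/2" by (simp add: dbar_def dist_commute)
    moreover obtain x where "x \<in> X" "dist x y < e/2"
      using X(2)[of y] y(1) k(1) by (auto simp: mem_send)
    ultimately show ?thesis
      using dist_triangle_half_l[of x y e s] by (auto simp: dist_commute)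
  qed
  then show "\<exists>X. finite X \<and> (\<forall>s\<in>support_union U. \<exists>x\<in>X. dist x s < e)"
    using X(1) by blast
qed

lemma mtotally_bounded_of_support_union:
  fixes U :: "('a::metric_space \<Rightarrow> real) set"
  assumes U: "U \<subseteq> F1_USCB" and tb: "totally_bounded (support_union U)"
  shows "Metric_space.mtotally_bounded F1_USCB H_send U"
proof -
  interpret Metric_space "F1_USCB :: ('a \<Rightarrow> real) set" H_send by (rule Metric_space_H_send)
  show ?thesis
  proof (rule mtotally_boundedI_finite_image[OF U])
    fix e :: real assume e: "e > 0"
    \<comment> \<open>Equal traces on a \<open>d\<close>-net give distance at most \<open>2 * d\<close>; a third of \<open>e\<close> makes this
      less than \<open>e\<close>.\<close>
    obtain N :: "('a \<times> real) set"
      where N: "finite N" "\<And>u p. u \<in> U \<Longrightarrow> p \<in> send u \<Longrightarrow> \<exists>n\<in>N. dbar n p < e/3"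
      using finite_net_sendographs[OF tb, of "e/3"] e by auto
    let ?f = "\<lambda>u. net_trace (e/3) N (send u)"
    have "?f ` U \<subseteq> Pow N" by (auto simp: net_trace_def)
    then have "finite (?f ` U)" using N(1) by (simp add: finite_subset)
    moreover have "H_send u v < e" if "u \<in> U" "v \<in> U" "?f u = ?f v" for u v
    proof -
      have "Hausdorff dbar (send u) (send v) \<le> ennreal (2 * (e/3))"
        using that N(2) by (intro Hausdorff_le_of_net_trace_eq) auto
      then have "H_send u v \<le> 2 * (e/3)"
        using e unfolding H_send_def by (intro enn2real_leI) auto
      then show ?thesis using e by simp
    qed
    ultimately show "\<exists>f :: ('a \<Rightarrow> real) \<Rightarrow> ('a \<times> real) set. finite (f ` U) \<and> (\<forall>u\<in>U. \<forall>v\<in>U. f u = f v \<longrightarrow> H_send u v < e)"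
      by (intro exI[of _ ?f]) blast
  qed
qed

theorem theorem7p12:
  fixes U :: "('a::metric_space \<Rightarrow> real) set"
  assumes "U \<subseteq> F1_USCB"
  shows "Metric_space.mtotally_bounded F1_USCB H_send U \<longleftrightarrow> totally_bounded (support_union U)"
  using totally_bounded_support_union[OF assms] mtotally_bounded_of_support_union[OF assms] by blast

end
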